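(* Let $d \ge 1$, let $S$ be a finite alphabet, and let $X, Y \subset S^{\mathbb{Z}^d}$ be sofic shifts. Then the existential extension $E(X,Y)$ is sofic. If $d = 1$, then the universal extension $A(X,Y)$ is also sofic.
   Context: Let $d \ge 1$ and let $S$ be a finite alphabet. A ($d$-dimensional) pattern over $S$ is a function $P : D \to S$ with domain $D = D(P) \subset \mathbb{Z}^d$; $\mathcal{P}_d(S)$ is the set of patterns with finite domain. A configuration is a pattern with domain $\mathbb{Z}^d$. A pattern $P : D \to S$ occurs in a pattern $Q : E \to S$, written $P \sqsubset Q$, if there is $\vec w \in \mathbb{Z}^d$ such that for all $\vec v \in D$ we have $\vec v + \vec w \in E$ and $Q_{\vec v + \vec w} = P_{\vec v}$. Each set $F \subset \mathcal{P}_d(S)$ of forbidden patterns defines a subshift $\{x \in S^{\mathbb{Z}^d} : \forall P \in F,\ P \not\sqsubset x\}$; it is a subshift of finite type (SFT) if $F$ can be chosen finite. The language of a subshift $X$ is $\mathcal{B}(X) = \{P \in \mathcal{P}_d(S) : \exists x \in X,\ P \sqsubset x\}$, and $\mathcal{B}_D(X) = \mathcal{B}(X) \cap S^D$ for finite $D \subset \mathbb{Z}^d$. A block map $\phi : X \to Y$ between subshifts $X \subset S^{\mathbb{Z}^d}$, $Y \subset T^{\mathbb{Z}^d}$ is a function for which there are a finite $D \subset \mathbb{Z}^d$ and $\Phi : \mathcal{B}_D(X) \to T$ with $\phi(x)_{\vec v} = \Phi(x_{D + \vec v})$ for all $x \in X$ and $\vec v \in \mathbb{Z}^d$. A sofic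 shift is the image of an SFT under a block map. Quantifier extensions. Let $X, Y \subset S^{\mathbb{Z}^d}$ be subshifts, let $\diamond \notin S$ be a new symbol and $\hat S = S \cup \{\diamond\}$. For $P \in \mathcal{P}_d(\hat S)$ and $Q \in S^{D(P)}$, let $P^{(Q)} \in S^{D(P)}$ be the pattern with $P^{(Q)}_{\vec v} = Q_{\vec v}$ if $P_{\vec v} = \diamond$ and $P^{(Q)}_{\vec v} = P_{\vec v}$ otherwise. The universal extension $A(X,Y) \subset \hat S^{\mathbb{Z}^d}$ and the existential extension $E(X,Y) \subset \hat S^{\mathbb{Z}^d}$ are the subshifts with respective sets of forbidden patterns $\{P \in \mathcal{P}_d(\hat S) : \exists Q \in \mathcal{B}_{D(P)}(Y),\ P^{(Q)} \notin \mathcal{B}(X)\}$ and $\{P \in \mathcal{P}_d(\hat S) : \forall Q \in \mathcal{B}_{D(P)}(Y),\ P^{(Q)} \notin \mathcal{B}(X)\}$. *)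

theory Defs
  imports "HOL-Analysis.Finite_Cartesian_Product"
begin

text \<open>
  The group \<open>\<int>\<^sup>d\<close> is rendered as \<open>int ^ 'd\<close>, with \<open>d = CARD('d) \<ge> 1\<close>.
  Alphabets are explicit finite sets, and a pattern is a partial function whose domain
  is \<open>dom P\<close>; in particular a configuration is a partial function that is defined everywhere.
\<close>

type_synonym ('d, 'a) pattern = "int ^ 'd \<rightharpoonup> 'a"

definition finite_patterns :: "'a set \<Rightarrow> ('d::finite, 'a) pattern set" where
  "finite_patterns S = {P. finite (dom P) \<and> ran P \<subseteq> S}"

definition configurations :: "'a set \<Rightarrow> ('d::finite, 'a) pattern set" where
  "configurations S = {x. dom x = UNIV \<and> ran x \<subseteq> S}"

definition occurs :: "('d::finite, 'a) pattern \<Rightarrow> ('d, 'a) pattern \<Rightarrow> bool"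
    (infix \<open>\<sqsubset>\<^sub>p\<close> 50) where
  "P \<sqsubset>\<^sub>p Q \<longleftrightarrow> (\<exists>w. \<forall>v\<in>dom P. v + w \<in> dom Q \<and> Q (v + w) = P v)"

definition subshift_of :: "'a set \<Rightarrow> ('d::finite, 'a) pattern set \<Rightarrow> ('d, 'a) pattern set" where
  "subshift_of S F = {x \<in> configurations S. \<forall>P\<in>F. \<not> P \<sqsubset>\<^sub>p x}"

definition is_subshift :: "'a set \<Rightarrow> ('d::finite, 'a) pattern set \<Rightarrow> bool" where
  "is_subshift S X \<longleftrightarrow> (\<exists>F \<subseteq> finite_patterns S. X = subshift_of S F)"

definition is_SFT :: "'a set \<Rightarrow> ('d::finite, 'a) pattern set \<Rightarrow> bool" where
  "is_SFT S X \<longleftrightarrow> (\<exists>F \<subseteq> finite_patterns S. finite F \<and> X = subshift_of S F)"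

definition language :: "'a set \<Rightarrow> ('d::finite, 'a) pattern set \<Rightarrow> ('d, 'a) pattern set" where
  "language S X = {P \<in> finite_patterns S. \<exists>x\<in>X. P \<sqsubset>\<^sub>p x}"

definition language_on ::
    "'a set \<Rightarrow> (int ^ 'd::finite) set \<Rightarrow> ('d, 'a) pattern set \<Rightarrow> ('d, 'a) pattern set" where
  "language_on S D X = {P \<in> language S X. dom P = D}"

text \<open>
  The restriction of \<open>x\<close> to \<open>D + v\<close>, translated back so that its domain is \<open>D\<close>
  and a local rule defined on patterns of domain \<open>D\<close> applies to it.
\<close>

definition window ::
    "('d::finite, 'a) pattern \<Rightarrow> (int ^ 'd) set \<Rightarrow> int ^ 'd \<Rightarrow> ('d, 'a) pattern" where
  "window x D v = (\<lambda>u. x (u + v)) |` D"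

definition block_map ::
    "'a set \<Rightarrow> ('d::finite, 'a) pattern set \<Rightarrow> 'b set \<Rightarrow> ('d, 'b) pattern set \<Rightarrow>
     (('d, 'a) pattern \<Rightarrow> ('d, 'b) pattern) \<Rightarrow> bool" where
  "block_map S X T Y \<phi> \<longleftrightarrow>
     is_subshift S X \<and> is_subshift T Y \<and> \<phi> ` X \<subseteq> Y \<and>
     (\<exists>D \<Phi>. finite D \<and> \<Phi> ` language_on S D X \<subseteq> T \<and>
        (\<forall>x\<in>X. \<forall>v. \<phi> x v = Some (\<Phi> (window x D v))))"

text \<open>
  The SFT cover may use an arbitrary finite alphabet. Every finite alphabet is in bijection
  with a finite set of natural numbers, so letting \<open>T\<close> range over finite sets of naturals
  avoids quantifying over types without losing any covers.
\<close>

definition is_sofic :: "'a set \<Rightarrow> ('d::finite, 'a) pattern set \<Rightarrow> bool" where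
  "is_sofic S Y \<longleftrightarrow>
     (\<exists>(T :: nat set) X Z \<phi>. finite T \<and> is_SFT T X \<and> block_map T X S Z \<phi> \<and> Y = \<phi> ` X)"

text \<open>
  In what follows \<open>dia\<close> is the additional symbol, which is assumed not to belong to \<open>S\<close>
  where these definitions are used; the extended alphabet is \<open>insert dia S\<close>.
\<close>

definition fill ::
    "'a \<Rightarrow> ('d::finite, 'a) pattern \<Rightarrow> ('d, 'a) pattern \<Rightarrow> ('d, 'a) pattern" where
  "fill dia P Q = (\<lambda>v. if P v = Some dia then Q v else P v)"

definition universal_extension ::
    "'a \<Rightarrow> 'a set \<Rightarrow> ('d::finite, 'a) pattern set \<Rightarrow> ('d, 'a) pattern set \<Rightarrow>
     ('d, 'a) pattern set" where
  "universal_extension dia S X Y = subshift_of (insert dia S)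
     {P \<in> finite_patterns (insert dia S).
        \<exists>Q\<in>language_on S (dom P) Y. fill dia P Q \<notin> language S X}"

definition existential_extension ::
    "'a \<Rightarrow> 'a set \<Rightarrow> ('d::finite, 'a) pattern set \<Rightarrow> ('d, 'a) pattern set \<Rightarrow>
     ('d, 'a) pattern set" where
  "existential_extension dia S X Y = subshift_of (insert dia S)
     {P \<in> finite_patterns (insert dia S).
        \<forall>Q\<in>language_on S (dom P) Y. fill dia P Q \<notin> language S X}"

end

theory Submission
  imports Defs "HOL-Analysis.Function_Topology"
begin

text \<open>
  Both extensions are defined through finite patterns, but compactness turns these definitions
  into conditions on whole configurations: \<open>x\<close> lies in the existential (universal) extension iff
  filling its holes from some (every) \<open>y \<in> Y\<close> gives a point of \<open>X\<close>
  (\<open>existential_extension_pointwise\<close>, \<open>universal_extension_pointwise\<close>). The compactness needed is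
  that a sofic shift is closed under pointwise approximation (\<open>sofic_closed\<close>).

  For the existential extension, the two points that witness membership can be guessed by a
  cover: superpose \<open>x\<close>, a point of the SFT above \<open>X\<close> and a point of the SFT above \<open>Y\<close>, require
  locally that the image of the first is the filling of \<open>x\<close> by the image of the second, and
  project to \<open>x\<close> (\<open>is_sofic_existential_pointwise\<close>).

  A universal quantifier over \<open>y\<close> cannot be guessed, but in dimension one it can be
  determinized away. There sofic shifts are the label sequences of bi-infinite paths in finite
  graphs (\<open>sofic_line_graph\<close>). Reading \<open>x\<close> from left to right, starting at an arbitrary cell,
  one records for a path of the graph of \<open>Y\<close> its current vertex \<open>q\<close> together with the set \<open>R\<close> of
  vertices of the graph of \<open>X\<close> that can be reached by a path which reads the filled word. By
  compactness, all fillings of \<open>x\<close> lie in \<open>X\<close> iff no pair \<open>(q, {})\<close> is ever recorded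
  (\<open>labelled_path_iff_reach\<close>). The cover writes at each cell a set of pairs that contains the
  initial ones, is closed under reading one more symbol and contains no pair \<open>(q, {})\<close>. These
  are nearest-neighbour conditions, and the cover may write more pairs than are reachable
  without doing harm, so nothing nonlocal has to be enforced
  (\<open>is_sofic_universal_pointwise_line\<close>).
\<close>

section \<open>Locally determined functions and compactness\<close>

definition depends_on :: "'i set \<Rightarrow> (('i \<Rightarrow> 'b) \<Rightarrow> 'c) \<Rightarrow> bool" where
  "depends_on D F \<longleftrightarrow> (\<forall>f g. (\<forall>u\<in>D. f u = g u) \<longrightarrow> F f = F g)"

lemma depends_onD: "depends_on D F \<Longrightarrow> (\<And>u. u \<in> D \<Longrightarrow> f u = g u) \<Longrightarrow> F f = F g"
  by (simp add: depends_on_def)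

text \<open>
  The compactness principle behind everything below: the assignments \<open>'i \<Rightarrow> T\<close> form a compact
  space by Tychonoff's theorem, and a constraint that inspects finitely many coordinates cuts
  out a closed set.
\<close>

lemma locally_finite_constraints_satisfiable:
  fixes C :: "'j \<Rightarrow> ('i \<Rightarrow> 'b) \<Rightarrow> bool"
  assumes fin: "finite T"
    and dep: "\<And>j. \<exists>D. finite D \<and> depends_on D (C j)"
    and sat: "\<And>J. finite J \<Longrightarrow> \<exists>f. range f \<subseteq> T \<and> (\<forall>j\<in>J. C j f)"
  shows "\<exists>f. range f \<subseteq> T \<and> (\<forall>j. C j f)"
proof -
  define X where "X = product_topology (\<lambda>_::'i. discrete_topology T) UNIV"
  have top: "topspace X = {f. range f \<subseteq> T}"
    by (auto simp: X_def PiE_def extensional_def)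
  define K where "K j = {f. range f \<subseteq> T \<and> C j f}" for j
  have compact: "compact_space X"
    unfolding X_def using fin by (simp add: compact_space_product_topology compact_space_discrete_topology)
  have closed: "closedin X (K j)" for j
  proof -
    obtain D where D: "finite D" "depends_on D (C j)" using dep by blast
    have "openin X {f. range f \<subseteq> T \<and> \<not> C j f}"
      unfolding X_def openin_product_topology_alt
    proof
      fix f assume f: "f \<in> {f. range f \<subseteq> T \<and> \<not> C j f}"
      \<comment> \<open>Fixing the coordinates in \<open>D\<close> gives a basic open box on which \<open>C j\<close> is constant.\<close>
      define U where "U i = (if i \<in> D then {f i} else T)" for i
      have "finite {i \<in> UNIV. U i \<noteq> topspace (discrete_topology T)}"
        by (rule finite_subset[OF _ D(1)]) (auto simp: U_def)
      moreover have "\<forall>i\<in>UNIV. openin (discrete_topology T) (U i)"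
        using f by (auto simp: U_def)
      moreover have "f \<in> Pi\<^sub>E UNIV U" using f by (auto simp: U_def)
      moreover have "Pi\<^sub>E UNIV U \<subseteq> {f. range f \<subseteq> T \<and> \<not> C j f}"
      proof
        fix g assume g: "g \<in> Pi\<^sub>E UNIV U"
        then have gU: "g i \<in> U i" for i by auto
        have "g i \<in> T" for i using gU[of i] f by (auto simp: U_def split: if_splits)
        moreover have "C j g = C j f"
        proof (rule depends_onD[OF D(2)])
          show "g u = f u" if "u \<in> D" for u using gU[of u] that by (simp add: U_def)
        qed
        ultimately show "g \<in> {f. range f \<subseteq> T \<and> \<not> C j f}" using f by auto
      qed
      ultimately show "\<exists>U. finite {i \<in> UNIV. U i \<noteq> topspace (discrete_topology T)} \<and>
          (\<forall>i\<in>UNIV. openin (discrete_topology T) (U i)) \<and> f \<in> Pi\<^sub>E UNIV U \<and>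
          Pi\<^sub>E UNIV U \<subseteq> {f. range f \<subseteq> T \<and> \<not> C j f}" by blast
    qed
    moreover have "{f. range f \<subseteq> T \<and> \<not> C j f} = topspace X - K j"
      by (auto simp: top K_def)
    ultimately show ?thesis by (auto simp: closedin_def top K_def)
  qed
  have fip: "\<Inter>\<F> \<noteq> {}" if F: "finite \<F>" "\<F> \<subseteq> range K" for \<F>
  proof -
    obtain J where "finite J" "\<F> = K ` J"
      using finite_subset_image[OF F] by blast
    moreover obtain f where "range f \<subseteq> T" "\<forall>j\<in>J. C j f" using sat[OF \<open>finite J\<close>] by blast
    ultimately have "f \<in> \<Inter>\<F>" by (simp add: K_def)
    then show ?thesis by blast
  qed
  have "\<Inter>(range K) \<noteq> {}"
    using compact[unfolded compact_space_fip, rule_format, of "range K"] closed fip by blast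
  then obtain f where "f \<in> K j" for j by blast
  then show ?thesis unfolding K_def by blast
qed

section \<open>Sofic shifts as projected tilings\<close>

definition translate :: "'i::ab_group_add \<Rightarrow> ('i \<Rightarrow> 'b) \<Rightarrow> 'i \<Rightarrow> 'b" where
  "translate v t = (\<lambda>u. t (u + v))"

lemma translate_apply [simp]: "translate v t u = t (u + v)"
  by (simp add: translate_def)

lemma translate_0 [simp]: "translate 0 t = t"
  by (simp add: translate_def)

lemma translate_translate: "translate v (translate w t) = translate (v + w) t"
  by (simp add: translate_def add.assoc)

lemma comp_translate: "g \<circ> translate v t = translate v (g \<circ> t)"
  by (simp add: fun_eq_iff)

lemma depends_on_translate:
  "depends_on D F \<Longrightarrow> depends_on ((\<lambda>u. u + v) ` D) (\<lambda>t. F (translate v t))"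
  by (simp add: depends_on_def)

text \<open>
  An SFT over an arbitrary type of symbols: total functions and a local rule take the place of
  partial functions and a finite list of forbidden patterns.
\<close>

definition tilings :: "'b set \<Rightarrow> (('i::ab_group_add \<Rightarrow> 'b) \<Rightarrow> bool) \<Rightarrow> ('i \<Rightarrow> 'b) set" where
  "tilings T A = {t. range t \<subseteq> T \<and> (\<forall>v. A (translate v t))}"

lemma configurationsD:
  assumes "x \<in> configurations S"
  shows "\<exists>a\<in>S. x v = Some a"
proof -
  have "v \<in> dom x" "ran x \<subseteq> S" using assms by (simp_all add: configurations_def)
  then show ?thesis by (auto simp: ran_def)
qed

lemma configurationsI:
  assumes "\<And>v. \<exists>a\<in>S. x v = Some a"
  shows "x \<in> configurations S"
proof -
  have "x v \<noteq> None" for v using assms[of v] by auto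
  moreover have "a \<in> S" if "x v = Some a" for v a using assms[of v] that by auto
  ultimately show ?thesis by (auto simp: configurations_def ran_def)
qed

lemma
  assumes "x \<in> configurations S"
  shows dom_config_restrict: "dom (translate w x |` D) = D"
    and config_restrict_finite_pattern: "finite D \<Longrightarrow> translate w x |` D \<in> finite_patterns S"
proof -
  have "v \<in> dom (translate w x)" for v
    using configurationsD[OF assms, of "v + w"] by auto
  then show *: "dom (translate w x |` D) = D" by auto
  have "ran (translate w x |` D) \<subseteq> S"
    using assms by (force simp: configurations_def ran_def restrict_map_def split: if_splits)
  then show "finite D \<Longrightarrow> translate w x |` D \<in> finite_patterns S"
    using * by (simp add: finite_patterns_def)
qed

text \<open>
  This is how covers are built below. The symbols may have any type, because an injection
  recodes the finite alphabet by numbers; a finite alphabet and window leave only finitely many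
  patterns that violate the rule, so the tilings do form an SFT.
\<close>

lemma is_soficI:
  fixes T :: "'b set" and A :: "(int ^ 'd::finite \<Rightarrow> 'b) \<Rightarrow> bool"
  assumes fin: "finite T" and D: "finite D" and dep: "depends_on D A"
    and lab: "lab ` T \<subseteq> S"
  shows "is_sofic S {y. \<exists>t\<in>tilings T A. \<forall>v. y v = Some (lab (t v))}"
proof -
  obtain e :: "'b \<Rightarrow> nat" where inj: "inj_on e T"
    using finite_imp_inj_to_nat_seg[OF fin] by blast
  define dec where "dec = (\<lambda>n. inv_into T e (the n))"
  have dec: "dec (Some (e b)) = b" if "b \<in> T" for b
    using that inj by (simp add: dec_def)
  have decT: "dec n \<in> T" if "n \<in> Some ` e ` T" for n
    using that dec by auto
  define F :: "('d, nat) pattern set"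
    where "F = {P. dom P = D \<and> ran P \<subseteq> e ` T \<and> \<not> A (dec \<circ> P)}"
  define X where "X = subshift_of (e ` T) F"
  define \<phi> :: "('d, nat) pattern \<Rightarrow> ('d, 'a) pattern"
    where "\<phi> x = (\<lambda>v. Some (lab (dec (x v))))" for x
  have F_fp: "F \<subseteq> finite_patterns (e ` T)"
    using D by (auto simp: F_def finite_patterns_def)
  have "finite F"
    by (rule finite_subset[OF _ finite_set_of_finite_maps[OF D finite_imageI[OF fin, of e]]])
      (auto simp: F_def)
  then have sft: "is_SFT (e ` T) X"
    unfolding is_SFT_def X_def using F_fp by blast
  have X_iff: "x \<in> X \<longleftrightarrow> x \<in> configurations (e ` T) \<and> (\<forall>w. A (translate w (dec \<circ> x)))" for x
  proof (cases "x \<in> configurations (e ` T)")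
    case True
    have rest: "A (dec \<circ> (translate w x |` D)) = A (translate w (dec \<circ> x))" for w
      by (rule depends_onD[OF dep]) simp
    have "(\<exists>P\<in>F. P \<sqsubset>\<^sub>p x) \<longleftrightarrow> (\<exists>w. \<not> A (translate w (dec \<circ> x)))"
    proof
      assume "\<exists>P\<in>F. P \<sqsubset>\<^sub>p x"
      then obtain P w where P: "P \<in> F" "\<forall>v\<in>dom P. x (v + w) = P v"
        by (auto simp: occurs_def)
      then have "P = translate w x |` D"
        by (auto simp: F_def fun_eq_iff restrict_map_def)
      with P rest show "\<exists>w. \<not> A (translate w (dec \<circ> x))" by (auto simp: F_def)
    next
      assume "\<exists>w. \<not> A (translate w (dec \<circ> x))"
      then obtain w where w: "\<not> A (translate w (dec \<circ> x))" by blast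
      let ?P = "translate w x |` D"
      have d: "v \<in> dom x" for v using True by (auto simp: configurations_def)
      have "?P \<in> F"
        using w rest D dom_config_restrict[OF True, of w D]
          config_restrict_finite_pattern[OF True, of D w]
        by (simp add: F_def finite_patterns_def)
      moreover have "?P \<sqsubset>\<^sub>p x" using d by (auto simp: occurs_def)
      ultimately show "\<exists>P\<in>F. P \<sqsubset>\<^sub>p x" by blast
    qed
    with True show ?thesis by (auto simp: X_def subshift_of_def)
  qed (auto simp: X_def subshift_of_def)
  have val: "x v \<in> Some ` e ` T" if "x \<in> configurations (e ` T)" for x :: "('d, nat) pattern" and v
    using configurationsD[OF that, of v] by auto
  have full: "is_subshift S (configurations S :: ('d, 'a) pattern set)"
    unfolding is_subshift_def subshift_of_def by (intro exI[of _ "{}"]) auto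
  have "block_map (e ` T) X S (configurations S) \<phi>"
    unfolding block_map_def
  proof (intro conjI exI[of _ "{0}"] exI[of _ "\<lambda>P. lab (dec (P 0))"])
    show "is_subshift (e ` T) X" using F_fp unfolding is_subshift_def X_def by blast
    show "is_subshift S (configurations S :: ('d, 'a) pattern set)" by (rule full)
    show "\<phi> ` X \<subseteq> configurations S"
    proof
      fix y assume "y \<in> \<phi> ` X"
      then obtain x where x: "x \<in> X" "y = \<phi> x" by blast
      then have "x \<in> configurations (e ` T)" using X_iff by simp
      then have "dec (x v) \<in> T" for v by (intro decT val)
      then show "y \<in> configurations S"
        using x lab by (auto simp: \<phi>_def configurations_def ran_def)
    qed
    show "finite {0}" by simp
    show "(\<lambda>P. lab (dec (P 0))) ` language_on (e ` T) {0} X \<subseteq> S"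
    proof
      fix a assume "a \<in> (\<lambda>P. lab (dec (P 0))) ` language_on (e ` T) {0} X"
      then obtain P where P: "P \<in> language_on (e ` T) {0} X" "a = lab (dec (P 0))" by blast
      then obtain n where "P 0 = Some n" "ran P \<subseteq> e ` T"
        by (auto simp: language_on_def language_def finite_patterns_def dom_def set_eq_iff)
      then have "P 0 \<in> Some ` e ` T" by (auto simp: ran_def)
      with P(2) decT lab show "a \<in> S" by blast
    qed
    show "\<forall>x\<in>X. \<forall>v. \<phi> x v = Some (lab (dec (window x {0} v 0)))"
      by (simp add: \<phi>_def window_def)
  qed
  moreover have "{y. \<exists>t\<in>tilings T A. \<forall>v. y v = Some (lab (t v))} = \<phi> ` X"
  proof (intro equalityI subsetI)
    fix y assume "y \<in> {y. \<exists>t\<in>tilings T A. \<forall>v. y v = Some (lab (t v))}"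
    then obtain t where t: "t \<in> tilings T A" "\<forall>v. y v = Some (lab (t v))" by blast
    let ?x = "\<lambda>v. Some (e (t v))"
    have "t v \<in> T" for v using t by (auto simp: tilings_def)
    then have dt: "dec \<circ> ?x = t" and c: "?x \<in> configurations (e ` T)"
      by (auto simp: dec configurations_def ran_def)
    have "?x \<in> X" unfolding X_iff using c t dt by (simp add: tilings_def)
    moreover have "y = \<phi> ?x" using t dt by (auto simp: \<phi>_def fun_eq_iff)
    ultimately show "y \<in> \<phi> ` X" by blast
  next
    fix y assume "y \<in> \<phi> ` X"
    then obtain x where x: "x \<in> X" "y = \<phi> x" by blast
    then have "dec \<circ> x \<in> tilings T A"
      using val decT unfolding X_iff tilings_def by auto
    with x show "y \<in> {y. \<exists>t\<in>tilings T A. \<forall>v. y v = Some (lab (t v))}"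
      by (auto simp: \<phi>_def intro!: bexI[of _ "dec \<circ> x"])
  qed
  ultimately show ?thesis
    unfolding is_sofic_def using fin sft
    by (intro exI[of _ "e ` T"] exI[of _ X] exI[of _ "configurations S"] exI[of _ \<phi>]) simp
qed

text \<open>
  Conversely, the single window \<open>D\<close> is the union of the window of the block map and the domains
  of all forbidden patterns of the cover.
\<close>

lemma is_soficE:
  fixes Y :: "('d::finite, 'a) pattern set"
  assumes "is_sofic S Y"
  obtains T :: "nat set" and D A \<Phi> where "finite T" "finite D" "depends_on D A" "depends_on D \<Phi>"
    "Y = {y. \<exists>t\<in>tilings T A. \<forall>v. y v = Some (\<Phi> (translate v t))}"
proof -
  obtain T :: "nat set" and X Z \<phi> where T: "finite T" and X: "is_SFT T X"
    and bm: "block_map T X S Z \<phi>" and Y: "Y = \<phi> ` X"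
    using assms unfolding is_sofic_def by blast
  obtain F where F: "F \<subseteq> finite_patterns T" "finite F" "X = subshift_of T F"
    using X unfolding is_SFT_def by blast
  obtain D\<^sub>1 \<Phi> where D\<^sub>1: "finite D\<^sub>1" "\<And>x v. x \<in> X \<Longrightarrow> \<phi> x v = Some (\<Phi> (window x D\<^sub>1 v))"
    using bm unfolding block_map_def by (elim conjE exE) simp
  define D where "D = D\<^sub>1 \<union> (\<Union>P\<in>F. dom P)"
  define A where "A t \<longleftrightarrow> (\<forall>P\<in>F. \<exists>v\<in>dom P. P v \<noteq> Some (t v))" for t :: "int ^ 'd \<Rightarrow> nat"
  define \<Psi> where "\<Psi> t = \<Phi> ((Some \<circ> t) |` D\<^sub>1)" for t
  have X_iff: "Some \<circ> t \<in> X \<longleftrightarrow> t \<in> tilings T A" for t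
  proof -
    have "Some \<circ> t \<in> configurations T \<longleftrightarrow> range t \<subseteq> T"
      by (auto simp: configurations_def ran_def)
    moreover have "(\<forall>P\<in>F. \<not> P \<sqsubset>\<^sub>p Some \<circ> t) \<longleftrightarrow> (\<forall>w. A (translate w t))"
      unfolding occurs_def A_def by (simp add: domIff) metis
    ultimately show ?thesis by (simp add: F(3) subshift_of_def tilings_def)
  qed
  have total: "Some \<circ> (the \<circ> x) = x" if "x \<in> X" for x
    using that by (auto simp: F(3) subshift_of_def configurations_def fun_eq_iff dom_def set_eq_iff)
  have \<phi>: "\<phi> (Some \<circ> t) v = Some (\<Psi> (translate v t))" if "Some \<circ> t \<in> X" for t v
    using D\<^sub>1(2)[OF that] by (simp add: \<Psi>_def window_def translate_def comp_def)
  show thesis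
  proof (rule that[of T D A \<Psi>])
    show "finite D" using D\<^sub>1 F by (auto simp: D_def finite_patterns_def)
    show "depends_on D A"
      unfolding depends_on_def
    proof (intro allI impI)
      fix f g :: "int ^ 'd \<Rightarrow> nat" assume "\<forall>u\<in>D. f u = g u"
      then have "\<forall>P\<in>F. \<forall>v\<in>dom P. f v = g v" unfolding D_def by blast
      then show "A f = A g" unfolding A_def by metis
    qed
    show "depends_on D \<Psi>"
      unfolding depends_on_def
    proof (intro allI impI)
      fix f g :: "int ^ 'd \<Rightarrow> nat" assume "\<forall>u\<in>D. f u = g u"
      then have "(Some \<circ> f) |` D\<^sub>1 = (Some \<circ> g) |` D\<^sub>1"
        by (simp add: D_def fun_eq_iff restrict_map_def)
      then show "\<Psi> f = \<Psi> g" by (simp add: \<Psi>_def)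
    qed
    show "Y = {y. \<exists>t\<in>tilings T A. \<forall>v. y v = Some (\<Psi> (translate v t))}"
    proof (intro equalityI subsetI)
      fix y assume "y \<in> Y"
      then obtain x where x: "x \<in> X" "y = \<phi> x" using Y by blast
      then show "y \<in> {y. \<exists>t\<in>tilings T A. \<forall>v. y v = Some (\<Psi> (translate v t))}"
        using X_iff[of "the \<circ> x"] \<phi>[of "the \<circ> x"] total[of x] by auto
    next
      fix y assume "y \<in> {y. \<exists>t\<in>tilings T A. \<forall>v. y v = Some (\<Psi> (translate v t))}"
      then obtain t where t: "t \<in> tilings T A" "\<forall>v. y v = Some (\<Psi> (translate v t))" by blast
      then have "Some \<circ> t \<in> X" "y = \<phi> (Some \<circ> t)"
        using X_iff \<phi> by (auto simp: fun_eq_iff)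
      then show "y \<in> Y" using Y by blast
    qed
  qed (fact T)
qed

lemma sofic_subset_configurations: "is_sofic S Y \<Longrightarrow> Y \<subseteq> configurations S"
  by (auto simp: is_sofic_def block_map_def is_subshift_def subshift_of_def)

lemma sofic_translate:
  assumes "is_sofic S Y" "y \<in> Y"
  shows "translate w y \<in> Y"
proof -
  obtain T :: "nat set" and D A \<Phi>
    where Y: "Y = {y. \<exists>t\<in>tilings T A. \<forall>v. y v = Some (\<Phi> (translate v t))}"
    by (rule is_soficE[OF assms(1)])
  then obtain t where t: "t \<in> tilings T A" "\<forall>v. y v = Some (\<Phi> (translate v t))"
    using assms(2) by blast
  then have "translate w t \<in> tilings T A"
    by (auto simp: tilings_def translate_translate)
  moreover have "translate w y v = Some (\<Phi> (translate v (translate w t)))" for v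
    using t by (simp add: translate_translate)
  ultimately show ?thesis unfolding Y by blast
qed

text \<open>
  The approximating points come with tilings that may be unrelated to each other; compactness of
  the space of tilings supplies one tiling whose image is \<open>c\<close> everywhere.
\<close>

lemma sofic_closed:
  fixes Y :: "('d::finite, 'a) pattern set"
  assumes "is_sofic S Y"
    and approx: "\<And>V. finite V \<Longrightarrow> \<exists>y\<in>Y. \<forall>v\<in>V. y v = c v"
  shows "c \<in> Y"
proof -
  obtain T :: "nat set" and D A \<Phi> where T: "finite T" and D: "finite D" "depends_on D A"
    "depends_on D \<Phi>" and Y: "Y = {y. \<exists>t\<in>tilings T A. \<forall>v. y v = Some (\<Phi> (translate v t))}"
    by (rule is_soficE[OF assms(1)])
  define C where "C v t \<longleftrightarrow> A (translate v t) \<and> c v = Some (\<Phi> (translate v t))" for v t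
  have "\<exists>t. range t \<subseteq> T \<and> (\<forall>v. C v t)"
  proof (rule locally_finite_constraints_satisfiable[OF T])
    fix v
    have "depends_on ((\<lambda>u. u + v) ` D) (C v)"
      using depends_onD[OF depends_on_translate[OF D(2), of v]]
        depends_onD[OF depends_on_translate[OF D(3), of v]]
      unfolding depends_on_def[of _ "C v"] C_def by metis
    then show "\<exists>D. finite D \<and> depends_on D (C v)" using D(1) by blast
  next
    fix V :: "(int ^ 'd) set" assume "finite V"
    then obtain y where y: "y \<in> Y" "\<forall>v\<in>V. y v = c v" using approx by blast
    then obtain t where "t \<in> tilings T A" "\<forall>v. y v = Some (\<Phi> (translate v t))"
      unfolding Y by blast
    with y(2) show "\<exists>t. range t \<subseteq> T \<and> (\<forall>v\<in>V. C v t)"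
      by (intro exI[of _ t]) (auto simp: tilings_def C_def)
  qed
  then show ?thesis unfolding Y C_def tilings_def by blast
qed

section \<open>Quantifier extensions, pointwise\<close>

lemma occurs_config_iff:
  assumes "x \<in> configurations S"
  shows "P \<sqsubset>\<^sub>p x \<longleftrightarrow> (\<exists>w. P = translate w x |` dom P)"
proof -
  have "v \<in> dom x" for v using assms by (simp add: configurations_def)
  moreover have "(\<forall>v\<in>dom P. x (v + w) = P v) \<longleftrightarrow> P = translate w x |` dom P" for w
  proof
    assume "\<forall>v\<in>dom P. x (v + w) = P v"
    then show "P = translate w x |` dom P" by (auto simp: fun_eq_iff restrict_map_def domIff)
  next
    assume "P = translate w x |` dom P"
    then show "\<forall>v\<in>dom P. x (v + w) = P v" by (metis restrict_in translate_apply)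
  qed
  ultimately show ?thesis by (simp add: occurs_def)
qed

text \<open>
  Translation invariance of \<open>X\<close> removes the translation from the definition of the language.
\<close>

lemma language_sofic_iff:
  assumes "is_sofic S X"
  shows "P \<in> language S X \<longleftrightarrow> finite (dom P) \<and> (\<exists>x\<in>X. P = x |` dom P)"
proof
  assume "P \<in> language S X"
  then obtain x where x: "finite (dom P)" "x \<in> X" "P \<sqsubset>\<^sub>p x"
    by (auto simp: language_def finite_patterns_def)
  moreover have "x \<in> configurations S" using x sofic_subset_configurations[OF assms] by blast
  ultimately show "finite (dom P) \<and> (\<exists>x\<in>X. P = x |` dom P)"
    using occurs_config_iff sofic_translate[OF assms x(2)] by metis
next
  assume "finite (dom P) \<and> (\<exists>x\<in>X. P = x |` dom P)"
  then obtain x where x: "finite (dom P)" "x \<in> X" "P = translate 0 x |` dom P"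
    by (auto simp: translate_def)
  have c: "x \<in> configurations S" using x(2) sofic_subset_configurations[OF assms] by blast
  have "P \<in> finite_patterns S"
    using config_restrict_finite_pattern[OF c x(1), of 0] x(3) by metis
  moreover have "P \<sqsubset>\<^sub>p x" using occurs_config_iff[OF c] x(3) by blast
  ultimately show "P \<in> language S X" using x(2) unfolding language_def by blast
qed

lemma fill_translate_restrict:
  "fill dia (translate w x |` D) (translate w y |` D) = translate w (fill dia x y) |` D"
  by (auto simp: fill_def restrict_map_def)

lemma fill_configurations:
  assumes "x \<in> configurations (insert dia S)" "y \<in> configurations S"
  shows "fill dia x y \<in> configurations S"
proof (rule configurationsI)
  show "\<exists>a\<in>S. fill dia x y v = Some a" for v
    using configurationsD[OF assms(1), of v] configurationsD[OF assms(2), of v]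
    by (auto simp: fill_def)
qed

text \<open>
  If \<open>x\<close> is in the extension and \<open>y \<in> Y\<close>, every finite piece of the filling is in the language
  of \<open>X\<close>, so the filling is in the closed set \<open>X\<close>. Conversely, a word \<open>Q\<close> of \<open>Y\<close> that is to be
  filled in at \<open>w\<close> is cut out of some \<open>y \<in> Y\<close>, and after a translation \<open>y\<close> shows \<open>Q\<close> at \<open>w\<close>.
\<close>

lemma universal_extension_pointwise:
  assumes X: "is_sofic S X" and Y: "is_sofic S Y"
  shows "universal_extension dia S X Y =
    {x \<in> configurations (insert dia S). \<forall>y\<in>Y. fill dia x y \<in> X}" (is "?A = ?B")
proof (intro equalityI subsetI)
  fix x assume x: "x \<in> ?A"
  then have c: "x \<in> configurations (insert dia S)"
    by (simp add: universal_extension_def subshift_of_def)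
  have "fill dia x y \<in> X" if y: "y \<in> Y" for y
  proof (rule sofic_closed[OF X])
    fix D :: "(int ^ 'b) set" assume D: "finite D"
    have cy: "y \<in> configurations S" using y sofic_subset_configurations[OF Y] by blast
    let ?P = "x |` D" and ?Q = "y |` D"
    note P = config_restrict_finite_pattern[OF c D, of 0, unfolded translate_0]
      dom_config_restrict[OF c, of 0 D, unfolded translate_0]
    note Q = dom_config_restrict[OF cy, of 0 D, unfolded translate_0]
    have "?Q = y |` dom ?Q" unfolding Q ..
    then have "?Q \<in> language S Y"
      using Q D y unfolding language_sofic_iff[OF Y] by metis
    then have "?Q \<in> language_on S (dom ?P) Y" using P(2) Q by (simp add: language_on_def)
    moreover have "?P \<sqsubset>\<^sub>p x" using occurs_config_iff[OF c] P(2) translate_0 by metis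
    ultimately have "fill dia ?P ?Q \<in> language S X"
      using x P(1) unfolding universal_extension_def subshift_of_def by blast
    moreover have fr: "fill dia ?P ?Q = fill dia x y |` D"
      using fill_translate_restrict[of dia 0 x D y] by simp
    ultimately obtain z where z: "z \<in> X" "fill dia x y |` D = z |` dom (fill dia x y |` D)"
      unfolding fr language_sofic_iff[OF X] by blast
    moreover have "dom (fill dia x y |` D) = D"
      using dom_config_restrict[OF fill_configurations[OF c cy], of 0 D] unfolding translate_0 .
    ultimately have "z |` D = fill dia x y |` D" by metis
    then have "\<forall>v\<in>D. z v = fill dia x y v" by (metis restrict_in)
    with z show "\<exists>z\<in>X. \<forall>v\<in>D. z v = fill dia x y v" by blast
  qed
  with c show "x \<in> ?B" by blast
next
  fix x assume "x \<in> ?B"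
  then have c: "x \<in> configurations (insert dia S)" and x: "\<And>y. y \<in> Y \<Longrightarrow> fill dia x y \<in> X"
    by auto
  have "fill dia P Q \<in> language S X"
    if P: "P \<in> finite_patterns (insert dia S)" "P \<sqsubset>\<^sub>p x" and Q: "Q \<in> language_on S (dom P) Y" for P Q
  proof -
    obtain w where w: "P = translate w x |` dom P" using P(2) occurs_config_iff[OF c] by blast
    have "dom Q = dom P" "\<exists>y\<in>Y. Q = y |` dom Q"
      using Q unfolding language_on_def language_sofic_iff[OF Y] by blast+
    then obtain y where y: "y \<in> Y" "Q = y |` dom P" by metis
    let ?y = "translate (- w) y"
    have fX: "fill dia x ?y \<in> X" using x sofic_translate[OF Y y(1)] by blast
    have "y = translate w ?y" by (simp add: translate_translate)
    then have eq: "fill dia P Q = translate w (fill dia x ?y) |` dom P"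
      using w y(2) fill_translate_restrict by metis
    have cf: "fill dia x ?y \<in> configurations S" using fX sofic_subset_configurations[OF X] by blast
    have fin: "finite (dom P)" using P by (simp add: finite_patterns_def)
    show ?thesis
      unfolding language_sofic_iff[OF X] eq dom_config_restrict[OF cf]
      using fin sofic_translate[OF X fX] by blast
  qed
  with c show "x \<in> ?A" by (auto simp: universal_extension_def subshift_of_def)
qed

text \<open>
  The cover consists of triples: the visible symbol, a tiling for \<open>X\<close> and a tiling for \<open>Y\<close>.
\<close>

lemma is_sofic_existential_pointwise:
  fixes X Y :: "('d::finite, 'a) pattern set"
  assumes S: "finite S" and X: "is_sofic S X" and Y: "is_sofic S Y"
  shows "is_sofic (insert dia S) {x \<in> configurations (insert dia S). \<exists>y\<in>Y. fill dia x y \<in> X}"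
proof -
  obtain T\<^sub>1 :: "nat set" and D\<^sub>1 A\<^sub>1 \<Phi>\<^sub>1 where 1: "finite T\<^sub>1" "finite D\<^sub>1" "depends_on D\<^sub>1 A\<^sub>1"
    "depends_on D\<^sub>1 \<Phi>\<^sub>1" and X_eq: "X = {y. \<exists>t\<in>tilings T\<^sub>1 A\<^sub>1. \<forall>v. y v = Some (\<Phi>\<^sub>1 (translate v t))}"
    by (rule is_soficE[OF X])
  obtain T\<^sub>2 :: "nat set" and D\<^sub>2 A\<^sub>2 \<Phi>\<^sub>2 where 2: "finite T\<^sub>2" "finite D\<^sub>2" "depends_on D\<^sub>2 A\<^sub>2"
    "depends_on D\<^sub>2 \<Phi>\<^sub>2" and Y_eq: "Y = {y. \<exists>t\<in>tilings T\<^sub>2 A\<^sub>2. \<forall>v. y v = Some (\<Phi>\<^sub>2 (translate v t))}"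
    by (rule is_soficE[OF Y])
  define T where "T = insert dia S \<times> T\<^sub>1 \<times> T\<^sub>2"
  define A where "A f \<longleftrightarrow> A\<^sub>1 (fst \<circ> snd \<circ> f) \<and> A\<^sub>2 (snd \<circ> snd \<circ> f) \<and>
    \<Phi>\<^sub>1 (fst \<circ> snd \<circ> f) = (if fst (f 0) = dia then \<Phi>\<^sub>2 (snd \<circ> snd \<circ> f) else fst (f 0))"
    for f :: "int ^ 'd \<Rightarrow> 'a \<times> nat \<times> nat"
  have "is_sofic (insert dia S) {x. \<exists>t\<in>tilings T A. \<forall>v. x v = Some (fst (t v))}"
  proof (rule is_soficI)
    show "finite T" using S 1 2 by (simp add: T_def)
    show "finite (insert 0 (D\<^sub>1 \<union> D\<^sub>2))" using 1 2 by simp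
    show "depends_on (insert 0 (D\<^sub>1 \<union> D\<^sub>2)) A"
      unfolding depends_on_def
    proof (intro allI impI)
      fix f g :: "int ^ 'd \<Rightarrow> 'a \<times> nat \<times> nat"
      assume eq: "\<forall>u\<in>insert 0 (D\<^sub>1 \<union> D\<^sub>2). f u = g u"
      have "A\<^sub>1 (fst \<circ> snd \<circ> f) = A\<^sub>1 (fst \<circ> snd \<circ> g)" "\<Phi>\<^sub>1 (fst \<circ> snd \<circ> f) = \<Phi>\<^sub>1 (fst \<circ> snd \<circ> g)"
        by (rule depends_onD[OF 1(3)] depends_onD[OF 1(4)], simp add: eq)+
      moreover have "A\<^sub>2 (snd \<circ> snd \<circ> f) = A\<^sub>2 (snd \<circ> snd \<circ> g)"
        "\<Phi>\<^sub>2 (snd \<circ> snd \<circ> f) = \<Phi>\<^sub>2 (snd \<circ> snd \<circ> g)"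
        by (rule depends_onD[OF 2(3)] depends_onD[OF 2(4)], simp add: eq)+
      ultimately show "A f = A g" using eq by (simp add: A_def)
    qed
    show "fst ` T \<subseteq> insert dia S" by (auto simp: T_def)
  qed
  moreover have "{x. \<exists>t\<in>tilings T A. \<forall>v. x v = Some (fst (t v))} =
    {x \<in> configurations (insert dia S). \<exists>y\<in>Y. fill dia x y \<in> X}" (is "?L = ?R")
  proof (intro equalityI subsetI)
    fix x assume "x \<in> ?L"
    then obtain t where t: "range t \<subseteq> T" "\<And>v. A (translate v t)" "\<And>v. x v = Some (fst (t v))"
      by (auto simp: tilings_def)
    let ?t1 = "fst \<circ> snd \<circ> t" and ?t2 = "snd \<circ> snd \<circ> t"
    have tv: "t v \<in> T" for v using t(1) by blast
    have rng: "range ?t1 \<subseteq> T\<^sub>1" "range ?t2 \<subseteq> T\<^sub>2"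
      using tv by (auto simp: T_def mem_Times_iff)
    have rules: "A\<^sub>1 (translate v ?t1)" "A\<^sub>2 (translate v ?t2)"
      "\<Phi>\<^sub>1 (translate v ?t1) = (if fst (t v) = dia then \<Phi>\<^sub>2 (translate v ?t2) else fst (t v))" for v
      using t(2)[of v] by (simp_all add: A_def comp_translate)
    define y where "y v = Some (\<Phi>\<^sub>2 (translate v ?t2))" for v
    have tl: "?t1 \<in> tilings T\<^sub>1 A\<^sub>1" "?t2 \<in> tilings T\<^sub>2 A\<^sub>2"
      using rng rules(1,2) unfolding tilings_def by blast+
    then have "y \<in> Y" unfolding Y_eq y_def by blast
    moreover have "fill dia x y v = Some (\<Phi>\<^sub>1 (translate v ?t1))" for v
      using rules(3)[of v] t(3)[of v] by (simp add: fill_def y_def)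
    then have "fill dia x y \<in> X" unfolding X_eq using tl(1) by blast
    moreover have "x \<in> configurations (insert dia S)"
    proof (rule configurationsI)
      show "\<exists>a\<in>insert dia S. x v = Some a" for v
        using t(3)[of v] tv[of v] by (auto simp: T_def mem_Times_iff)
    qed
    ultimately show "x \<in> ?R" by blast
  next
    fix x assume "x \<in> ?R"
    then obtain y where c: "x \<in> configurations (insert dia S)" and y: "y \<in> Y" "fill dia x y \<in> X"
      by blast
    obtain t1 where t1: "t1 \<in> tilings T\<^sub>1 A\<^sub>1" "\<And>v. fill dia x y v = Some (\<Phi>\<^sub>1 (translate v t1))"
      using y(2) unfolding X_eq by blast
    obtain t2 where t2: "t2 \<in> tilings T\<^sub>2 A\<^sub>2" "\<And>v. y v = Some (\<Phi>\<^sub>2 (translate v t2))"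
      using y(1) unfolding Y_eq by blast
    define a where "a v = the (x v)" for v
    have a: "a v \<in> insert dia S" "x v = Some (a v)" for v
      using configurationsD[OF c, of v] by (auto simp: a_def)
    define t where "t v = (a v, t1 v, t2 v)" for v
    have proj: "fst \<circ> snd \<circ> t = t1" "snd \<circ> snd \<circ> t = t2" by (auto simp: t_def)
    have "A (translate v t)" for v
      unfolding A_def comp_translate proj
      using t1(1) t2(1) t1(2)[of v] t2(2)[of v] a(2)[of v]
      by (auto simp: tilings_def t_def fill_def)
    moreover have "range t \<subseteq> T"
      using a(1) t1(1) t2(1) by (auto simp: t_def T_def tilings_def)
    ultimately have "t \<in> tilings T A" by (simp add: tilings_def)
    moreover have "x v = Some (fst (t v))" for v by (simp add: t_def a(2))
    ultimately show "x \<in> ?L" by blast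
  qed
  ultimately show ?thesis by simp
qed

text \<open>
  The witnesses for different finite windows need not be compatible. As the right-hand side is
  already known to be sofic, hence closed, it suffices to approximate \<open>x\<close> on each window by a
  configuration that has global witnesses.
\<close>

lemma existential_extension_pointwise:
  fixes X Y :: "('d::finite, 'a) pattern set"
  assumes S: "finite S" and dia: "dia \<notin> S" and X: "is_sofic S X" and Y: "is_sofic S Y"
  shows "existential_extension dia S X Y =
    {x \<in> configurations (insert dia S). \<exists>y\<in>Y. fill dia x y \<in> X}" (is "?E = ?B")
proof (intro equalityI subsetI)
  fix x assume x: "x \<in> ?E"
  then have c: "x \<in> configurations (insert dia S)"
    by (simp add: existential_extension_def subshift_of_def)
  show "x \<in> ?B"
  proof (rule sofic_closed[OF is_sofic_existential_pointwise[OF S X Y]])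
    fix D :: "(int ^ 'd) set" assume D: "finite D"
    let ?P = "x |` D"
    note P = config_restrict_finite_pattern[OF c D, of 0, unfolded translate_0]
      dom_config_restrict[OF c, of 0 D, unfolded translate_0]
    have "?P \<sqsubset>\<^sub>p x" using occurs_config_iff[OF c] P(2) translate_0 by metis
    then obtain Q where Q: "Q \<in> language S Y" "dom Q = D" "fill dia ?P Q \<in> language S X"
      using x P unfolding existential_extension_def subshift_of_def language_on_def by blast
    obtain y where y: "y \<in> Y" "Q = y |` D"
      using Q(1,2) unfolding language_sofic_iff[OF Y] by metis
    have cy: "y \<in> configurations S" using y(1) sofic_subset_configurations[OF Y] by blast
    have fx: "fill dia ?P Q = fill dia x y |` D"
      using y(2) fill_translate_restrict[of dia 0 x D y] by simp
    then have "dom (fill dia ?P Q) = D"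
      using dom_config_restrict[OF fill_configurations[OF c cy], of 0 D] by simp
    then obtain z where z: "z \<in> X" "fill dia x y |` D = z |` D"
      using Q(3) fx unfolding language_sofic_iff[OF X] by metis
    have cz: "z \<in> configurations S" using z(1) sofic_subset_configurations[OF X] by blast
    \<comment> \<open>The approximation: outside \<open>D\<close> the symbols of \<open>z\<close>, none of which is the hole, leave nothing to fill.\<close>
    define x' where "x' v = (if v \<in> D then x v else z v)" for v
    have "x' \<in> configurations (insert dia S)"
    proof (rule configurationsI)
      show "\<exists>a\<in>insert dia S. x' v = Some a" for v
        using configurationsD[OF c, of v] configurationsD[OF cz, of v] by (auto simp: x'_def)
    qed
    moreover have "fill dia x' y = z"
    proof
      fix v
      show "fill dia x' y v = z v"
      proof (cases "v \<in> D")
        case True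
        then have "z v = fill dia x y v" using z(2) by (metis restrict_in)
        with True show ?thesis by (simp add: fill_def x'_def)
      next
        case False
        then show ?thesis using configurationsD[OF cz, of v] dia by (auto simp: fill_def x'_def)
      qed
    qed
    ultimately have "x' \<in> ?B" using y(1) z(1) by blast
    then show "\<exists>x'\<in>?B. \<forall>v\<in>D. x' v = x v" by (rule bexI[rotated]) (simp add: x'_def)
  qed
next
  fix x assume "x \<in> ?B"
  then obtain y where c: "x \<in> configurations (insert dia S)" and y: "y \<in> Y" "fill dia x y \<in> X"
    by blast
  have "\<exists>Q\<in>language_on S (dom P) Y. fill dia P Q \<in> language S X"
    if P: "P \<in> finite_patterns (insert dia S)" "P \<sqsubset>\<^sub>p x" for P
  proof -
    obtain w where w: "P = translate w x |` dom P" using P(2) occurs_config_iff[OF c] by blast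
    have fin: "finite (dom P)" using P(1) by (simp add: finite_patterns_def)
    have cy: "y \<in> configurations S" using y(1) sofic_subset_configurations[OF Y] by blast
    let ?Q = "translate w y |` dom P"
    have dQ: "dom ?Q = dom P" by (rule dom_config_restrict[OF cy])
    have "?Q \<in> language S Y"
      unfolding language_sofic_iff[OF Y] dQ using fin sofic_translate[OF Y y(1)] by blast
    then have "?Q \<in> language_on S (dom P) Y" using dQ unfolding language_on_def by blast
    moreover have eq: "fill dia P ?Q = translate w (fill dia x y) |` dom P"
      using w fill_translate_restrict by metis
    have "fill dia P ?Q \<in> language S X"
      unfolding language_sofic_iff[OF X] eq dom_config_restrict[OF fill_configurations[OF c cy]]
      using fin sofic_translate[OF X y(2)] by blast
    ultimately show ?thesis by blast
  qed
  with c show "x \<in> ?E" unfolding existential_extension_def subshift_of_def by blast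
qed

section \<open>Sofic shifts on the line as labelled paths\<close>

definition paths :: "'v set \<Rightarrow> ('v \<Rightarrow> 'v \<Rightarrow> bool) \<Rightarrow> (int \<Rightarrow> 'v) set" where
  "paths V E = {p. \<forall>i. p i \<in> V \<and> E (p i) (p (i + 1))}"

lemma paths_shift: "p \<in> paths V E \<Longrightarrow> (\<lambda>i. p (i + k)) \<in> paths V E"
  by (simp add: paths_def add.commute[of _ k] flip: add.assoc)

lemma paths_glue:
  assumes "p \<in> paths V E" "q \<in> paths V E" "E (p k) (q (k + 1))"
  shows "(\<lambda>i. if i \<le> k then p i else q i) \<in> paths V E"
proof -
  have "E (if i \<le> k then p i else q i) (if i + 1 \<le> k then p (i + 1) else q (i + 1))" for i
    using assms by (cases "i = k") (auto simp: paths_def)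
  then show ?thesis using assms by (auto simp: paths_def)
qed

text \<open>
  The subset construction for the graph of \<open>V\<close>: the endpoints of the paths that start at time
  \<open>j\<close>, end at time \<open>j + n\<close> and read \<open>c\<close> in between. Labels sit on vertices, so \<open>n + 1\<close> symbols
  are read.
\<close>

fun reach :: "'v set \<Rightarrow> ('v \<Rightarrow> 'v \<Rightarrow> bool) \<Rightarrow> ('v \<Rightarrow> 'a) \<Rightarrow> (int \<Rightarrow> 'a) \<Rightarrow> int \<Rightarrow> nat \<Rightarrow> 'v set" where
  "reach V E lab c j 0 = {p \<in> V. lab p = c j}"
| "reach V E lab c j (Suc n) =
    {q \<in> V. lab q = c (j + int (Suc n)) \<and> (\<exists>p\<in>reach V E lab c j n. E p q)}"

lemma reach_cong:
  "(\<And>i. j \<le> i \<Longrightarrow> i \<le> j + int n \<Longrightarrow> c i = c' i) \<Longrightarrow> reach V E lab c j n = reach V E lab c' j n"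
  by (induction n) auto

lemma reach_subset: "reach V E lab c j n \<subseteq> V"
  by (cases n) auto

lemma path_in_reach:
  assumes "w \<in> paths V E" "\<And>i. lab (w i) = c i"
  shows "w (j + int n) \<in> reach V E lab c j n"
proof (induction n)
  case 0
  show ?case using assms by (simp add: paths_def)
next
  case (Suc n)
  have "j + int (Suc n) = j + int n + 1" by simp
  then have "w (j + int (Suc n)) \<in> V" "E (w (j + int n)) (w (j + int (Suc n)))"
    using assms(1) by (simp_all only: paths_def mem_Collect_eq)
  with Suc show ?case using assms(2) by auto
qed

lemma reach_finite_path:
  assumes "q \<in> reach V E lab c j n"
  shows "\<exists>w. range w \<subseteq> V \<and> w (j + int n) = q \<and> (\<forall>i\<in>{j..j + int n}. lab (w i) = c i) \<and>
    (\<forall>i\<in>{j..<j + int n}. E (w i) (w (i + 1)))"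
  using assms
proof (induction n arbitrary: q)
  case 0
  then show ?case by (intro exI[of _ "\<lambda>_. q"]) auto
next
  case (Suc n)
  then obtain p where q: "q \<in> V" "lab q = c (j + int (Suc n))" "E p q"
    and p: "p \<in> reach V E lab c j n" by auto
  obtain w where w: "range w \<subseteq> V" "w (j + int n) = p" "\<forall>i\<in>{j..j + int n}. lab (w i) = c i"
    "\<forall>i\<in>{j..<j + int n}. E (w i) (w (i + 1))"
    using Suc.IH[OF p] by blast
  let ?w = "w(j + int (Suc n) := q)"
  have "lab (?w i) = c i" if "i \<in> {j..j + int (Suc n)}" for i
    using that w(3) q(2) by (cases "i = j + int (Suc n)") auto
  moreover have "E (?w i) (?w (i + 1))" if "i \<in> {j..<j + int (Suc n)}" for i
    using that w(2,4) q(3) by (cases "i = j + int n") (auto simp: add.assoc)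
  moreover have "range ?w \<subseteq> V" using w(1) q(1) by auto
  ultimately show ?case by (intro exI[of _ ?w]) auto
qed

text \<open>
  Nonempty reachable sets give labelled paths on every finite interval only, and these need not
  extend each other; compactness assembles a bi-infinite path.
\<close>

lemma labelled_path_iff_reach:
  fixes V :: "'v set"
  assumes V: "finite V"
  shows "(\<exists>w\<in>paths V E. \<forall>i. lab (w i) = c i) \<longleftrightarrow> (\<forall>j n. reach V E lab c j n \<noteq> {})"
proof
  assume "\<exists>w\<in>paths V E. \<forall>i. lab (w i) = c i"
  then show "\<forall>j n. reach V E lab c j n \<noteq> {}" using path_in_reach by (metis empty_iff)
next
  assume R: "\<forall>j n. reach V E lab c j n \<noteq> {}"
  define C where "C i w \<longleftrightarrow> lab (w i) = c i \<and> E (w i) (w (i + 1))" for i and w :: "int \<Rightarrow> 'v"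
  have "\<exists>w. range w \<subseteq> V \<and> (\<forall>i. C i w)"
  proof (rule locally_finite_constraints_satisfiable[OF V])
    show "\<exists>D. finite D \<and> depends_on D (C i)" for i
      by (rule exI[of _ "{i, i + 1}"]) (simp add: depends_on_def C_def)
  next
    fix J :: "int set" assume J: "finite J"
    \<comment> \<open>An interval that contains \<open>J\<close>; inserting \<open>0\<close> covers the case of empty \<open>J\<close>.\<close>
    define j n where "j = Min (insert 0 J)" and "n = nat (Max (insert 0 J) + 1 - j)"
    have J_bounds: "i \<in> {j..<j + int n}" if "i \<in> J" for i
    proof -
      have "j \<le> i" "i \<le> Max (insert 0 J)" using J that by (auto simp: j_def)
      then show ?thesis by (simp add: n_def)
    qed
    obtain q where q: "q \<in> reach V E lab c j n" using R by blast
    obtain w where "range w \<subseteq> V" "\<forall>i\<in>{j..j + int n}. lab (w i) = c i"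
      "\<forall>i\<in>{j..<j + int n}. E (w i) (w (i + 1))"
      using reach_finite_path[OF q] by blast
    then show "\<exists>w. range w \<subseteq> V \<and> (\<forall>i\<in>J. C i w)"
      using J_bounds unfolding C_def by (intro exI[of _ w]) fastforce
  qed
  then show "\<exists>w\<in>paths V E. \<forall>i. lab (w i) = c i"
    unfolding C_def paths_def by blast
qed

lemma line_coordinate:
  assumes "CARD('d::finite) = 1"
  obtains co :: "int ^ 'd \<Rightarrow> int" where "\<And>i. co (vec i) = i" "\<And>v. vec (co v) = v"
    "\<And>u v. co (u + v) = co u + co v"
proof -
  obtain a :: 'd where a: "UNIV = {a}" using assms by (rule card_1_singletonE)
  show thesis
  proof (rule that[of "\<lambda>v. v $ a"])
    show "vec (v $ a) = v" for v :: "int ^ 'd"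
      using a by (simp add: vec_eq_iff) (metis UNIV_I singletonD)
  qed simp_all
qed

text \<open>
  Higher block recoding: vertices are the legal words on \<open>{-m..m}\<close>, where \<open>m\<close> bounds the window
  of the cover, and an edge joins words that overlap when moved by one cell. A bi-infinite path
  is then the sequence of windows of a tiling.
\<close>

lemma sofic_line_graph:
  fixes X :: "('d::finite, 'a) pattern set"
  assumes dim: "CARD('d) = 1" and X: "is_sofic S X"
  obtains V :: "(int \<Rightarrow> nat) set" and E lab where "finite V"
    "X = {x. \<exists>p\<in>paths V E. \<forall>i. x (vec i) = Some (lab (p i))}"
proof -
  obtain co :: "int ^ 'd \<Rightarrow> int" where co: "\<And>i. co (vec i) = i" "\<And>v. vec (co v) = v"
    "\<And>u v. co (u + v) = co u + co v" using line_coordinate[OF dim] by blast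
  obtain T :: "nat set" and D A \<Phi> where T: "finite T" and D: "finite D" "depends_on D A"
    "depends_on D \<Phi>" and X_eq: "X = {y. \<exists>t\<in>tilings T A. \<forall>v. y v = Some (\<Phi> (translate v t))}"
    by (rule is_soficE[OF X])
  define m where "m = Max (insert 0 ((\<lambda>v. \<bar>co v\<bar>) ` D))"
  have m0: "m \<ge> 0" using D(1) by (simp add: m_def)
  have m: "co v \<in> {-m..m}" if "v \<in> D" for v
  proof -
    have "\<bar>co v\<bar> \<le> m" using D(1) that by (auto simp: m_def intro!: Max_ge)
    then show ?thesis by auto
  qed
  define V where "V = {g \<in> {-m..m} \<rightarrow>\<^sub>E T. A (g \<circ> co)}"
  define E where "E g h \<longleftrightarrow> (\<forall>k. -m \<le> k \<and> k < m \<longrightarrow> g (k + 1) = h k)" for g h :: "int \<Rightarrow> nat"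
  define lab where "lab g = \<Phi> (g \<circ> co)" for g
  have "finite V"
    by (rule finite_subset[of _ "{-m..m} \<rightarrow>\<^sub>E T"]) (use T in \<open>auto simp: V_def intro: finite_PiE\<close>)
  have window_eq: "A (g \<circ> co) = A (translate (vec i) t)" "\<Phi> (g \<circ> co) = \<Phi> (translate (vec i) t)"
    if "\<And>k. k \<in> {-m..m} \<Longrightarrow> g k = t (vec (i + k))" for g t i
  proof -
    have eq: "(g \<circ> co) u = translate (vec i) t u" if "u \<in> D" for u
    proof -
      have "vec (i + co u) = u + vec i" by (simp add: vec_add co(2) add.commute)
      then show ?thesis using \<open>\<And>k. k \<in> {-m..m} \<Longrightarrow> g k = t (vec (i + k))\<close> m[OF that] by simp
    qed
    show "A (g \<circ> co) = A (translate (vec i) t)" by (rule depends_onD[OF D(2) eq])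
    show "\<Phi> (g \<circ> co) = \<Phi> (translate (vec i) t)" by (rule depends_onD[OF D(3) eq])
  qed
  have "X = {x. \<exists>p\<in>paths V E. \<forall>i. x (vec i) = Some (lab (p i))}"
  proof (intro equalityI subsetI)
    fix x assume "x \<in> X"
    then obtain t where t: "range t \<subseteq> T" "\<And>v. A (translate v t)"
      "\<And>v. x v = Some (\<Phi> (translate v t))" unfolding X_eq tilings_def by blast
    define p where "p i = restrict (\<lambda>k. t (vec (i + k))) {-m..m}" for i
    have p: "p i k = t (vec (i + k))" if "k \<in> {-m..m}" for i k
      using that by (simp add: p_def)
    have "p i \<in> V" for i
      using window_eq(1)[of "p i" t i] p t(1,2) by (auto simp: V_def p_def)
    moreover have "E (p i) (p (i + 1))" for i
      by (auto simp: E_def p_def ac_simps)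
    moreover have "x (vec i) = Some (lab (p i))" for i
      using window_eq(2)[of "p i" t i] p t(3) by (simp add: lab_def)
    ultimately show "x \<in> {x. \<exists>p\<in>paths V E. \<forall>i. x (vec i) = Some (lab (p i))}"
      unfolding paths_def by blast
  next
    fix x :: "('d, 'a) pattern" assume "x \<in> {x. \<exists>p\<in>paths V E. \<forall>i. x (vec i) = Some (lab (p i))}"
    then obtain p where p: "\<And>i. p i \<in> V" "\<And>i. E (p i) (p (i + 1))"
      "\<And>i. x (vec i) = Some (lab (p i))" unfolding paths_def by blast
    \<comment> \<open>Every cell is read off the leftmost position of a window, so that a symbol inside any
      window is traced to its source by moving right only, which is a plain induction.\<close>
    define t where "t v = p (co v + m) (- m)" for v
    have slide: "p i (int n - m) = p (i + int n) (- m)" if "int n \<le> 2 * m" for i n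
      using that
    proof (induction n arbitrary: i)
      case (Suc n)
      then have "p i (int n - m + 1) = p (i + 1) (int n - m)" using p(2)[of i] by (simp add: E_def)
      with Suc show ?case by (simp add: algebra_simps)
    qed simp
    have win: "p i k = t (vec (i + k))" if "k \<in> {-m..m}" for i k
      using slide[of "nat (k + m)" i] that by (simp add: t_def co(1) add.assoc)
    have "range t \<subseteq> T"
    proof -
      have "t v \<in> T" for v
        using PiE_mem[of "p (co v)" "{-m..m}" "\<lambda>_. T" 0] p(1)[of "co v"] win[of 0 "co v"] m0
        by (simp add: V_def co(2))
      then show ?thesis by blast
    qed
    moreover have "A (translate v t)" "x v = Some (\<Phi> (translate v t))" for v
      using window_eq[of "p (co v)" t "co v"] win p(1)[of "co v"] p(3)[of "co v"]
      by (simp_all add: co(2) V_def lab_def)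
    ultimately show "x \<in> X" unfolding X_eq tilings_def by blast
  qed
  with \<open>finite V\<close> show thesis by (rule that)
qed

section \<open>The subset construction\<close>

text \<open>
  The cover symbol at a cell is the symbol \<open>a\<close> of \<open>x\<close> and a set of pairs \<open>(q, R)\<close>; the rule \<open>ok\<close>
  relates the symbols at two adjacent cells. If a cover point exists, induction along any path of
  the graph of \<open>Y\<close> finds its reachable sets among the recorded ones, so they are nonempty.
  Conversely, if all fillings of \<open>x\<close> lie in \<open>X\<close>, recording exactly the pairs that arise from some
  path and some starting time satisfies the rule.
\<close>

lemma is_sofic_universal_pointwise_line:
  fixes X Y :: "('d::finite, 'a) pattern set"
  assumes dim: "CARD('d) = 1" and S: "finite S" and X: "is_sofic S X" and Y: "is_sofic S Y"
  shows "is_sofic (insert dia S) {x \<in> configurations (insert dia S). \<forall>y\<in>Y. fill dia x y \<in> X}"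
proof -
  obtain co :: "int ^ 'd \<Rightarrow> int" where co: "\<And>i. co (vec i) = i" "\<And>v. vec (co v) = v"
    "\<And>u v. co (u + v) = co u + co v" using line_coordinate[OF dim] by blast
  obtain V :: "(int \<Rightarrow> nat) set" and E lab where V: "finite V"
    and X_eq: "X = {x. \<exists>p\<in>paths V E. \<forall>i. x (vec i) = Some (lab (p i))}"
    by (rule sofic_line_graph[OF dim X])
  obtain W :: "(int \<Rightarrow> nat) set" and F \<mu> where W: "finite W"
    and Y_eq: "Y = {y. \<exists>z\<in>paths W F. \<forall>i. y (vec i) = Some (\<mu> (z i))}"
    by (rule sofic_line_graph[OF dim Y])
  \<comment> \<open>Only vertices on bi-infinite paths matter: a pair \<open>(q, {})\<close> at any other vertex \<open>q\<close> says
    nothing about points of \<open>Y\<close> and must not be forbidden.\<close>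
  define W' where "W' = {z i | z i. z \<in> paths W F}"
  have W': "finite W'"
    by (rule finite_subset[OF _ W]) (auto simp: W'_def paths_def)
  have through: "\<exists>z\<in>paths W F. z i = q" if q: "q \<in> W'" for q i
  proof -
    obtain z k where "z \<in> paths W F" "q = z k" using q by (auto simp: W'_def)
    then show ?thesis
      using paths_shift[of z W F "k - i"] by (intro bexI[of _ "\<lambda>j. z (j + (k - i))"]) simp_all
  qed
  define fl where "fl a b = (if a = dia then b else a)" for a b
  have fill_eq: "fill dia x y (vec i) = Some (lab r) \<longleftrightarrow> lab r = fl a (\<mu> q)"
    if "x (vec i) = Some a" "y (vec i) = Some (\<mu> q)" for x y :: "('d, 'a) pattern" and i a q r
    using that by (auto simp: fill_def fl_def)
  define T where "T = insert dia S \<times> Pow (W' \<times> Pow V)"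
  define start where "start a q = {p \<in> V. lab p = fl a (\<mu> q)}" for a q
  define succ where "succ a q R = {p \<in> V. lab p = fl a (\<mu> q) \<and> (\<exists>r\<in>R. E r p)}" for a q R
  define ok where "ok s s' \<longleftrightarrow>
      (\<forall>q\<in>W'. (q, start (fst s) q) \<in> snd s \<and> (q, {}) \<notin> snd s) \<and>
      (\<forall>(q, R)\<in>snd s. \<forall>q'\<in>W'. F q q' \<longrightarrow> (q', succ (fst s') q' R) \<in> snd s')" for s s'
  define A where "A f = ok (f 0) (f (vec 1))" for f :: "int ^ 'd \<Rightarrow> 'a \<times> ((int \<Rightarrow> nat) \<times> (int \<Rightarrow> nat) set) set"
  have "is_sofic (insert dia S) {x. \<exists>t\<in>tilings T A. \<forall>v. x v = Some (fst (t v))}"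
  proof (rule is_soficI)
    show "finite T" using S W' V by (simp add: T_def)
    show "depends_on {0, vec 1} A" by (simp add: depends_on_def A_def)
    show "fst ` T \<subseteq> insert dia S" by (auto simp: T_def)
  qed simp
  moreover have "{x. \<exists>t\<in>tilings T A. \<forall>v. x v = Some (fst (t v))} =
    {x \<in> configurations (insert dia S). \<forall>y\<in>Y. fill dia x y \<in> X}" (is "?L = ?R")
  proof (intro equalityI subsetI)
    fix x assume "x \<in> ?L"
    then obtain t where t: "\<And>v. t v \<in> T" "\<And>v. A (translate v t)" "\<And>v. x v = Some (fst (t v))"
      unfolding tilings_def by blast
    define s where "s i = t (vec i)" for i
    have ok: "ok (s i) (s (i + 1))" for i
      using t(2)[of "vec i"] by (simp add: A_def s_def vec_add add.commute)
    have "fill dia x y \<in> X" if y: "y \<in> Y" for y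
    proof -
      obtain z where z: "z \<in> paths W F" "\<And>i. y (vec i) = Some (\<mu> (z i))"
        using y unfolding Y_eq by blast
      have zW: "z i \<in> W'" "F (z i) (z (i + 1))" for i
        using z(1) by (auto simp: W'_def paths_def)
      define c where "c i = fl (fst (s i)) (\<mu> (z i))" for i
      have U: "(z (j + int n), reach V E lab c j n) \<in> snd (s (j + int n))" for j n
      proof (induction n)
        case 0
        show ?case using ok[of j] zW(1)[of j] by (simp add: ok_def start_def c_def)
      next
        case (Suc n)
        have i: "j + int (Suc n) = j + int n + 1" by simp
        have "(z (j + int n + 1), succ (fst (s (j + int n + 1))) (z (j + int n + 1)) (reach V E lab c j n))
            \<in> snd (s (j + int n + 1))"
          using ok[of "j + int n"] Suc zW by (auto simp: ok_def)
        then show ?case unfolding i reach.simps succ_def c_def .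
      qed
      have "reach V E lab c j n \<noteq> {}" for j n
        using U[of j n] ok[of "j + int n"] zW(1)[of "j + int n"] by (auto simp: ok_def)
      then obtain w where w: "w \<in> paths V E" "\<And>i. lab (w i) = c i"
        using labelled_path_iff_reach[OF V] by metis
      have "fill dia x y (vec i) = Some (lab (w i))" for i
        using fill_eq[of x i "fst (s i)" y "z i" "w i"] t(3)[of "vec i"] z(2)[of i] w(2)[of i] by (simp add: c_def s_def)
      with w(1) show ?thesis unfolding X_eq by blast
    qed
    moreover have "x \<in> configurations (insert dia S)"
    proof (rule configurationsI)
      show "\<exists>a\<in>insert dia S. x v = Some a" for v
        using t(3)[of v] t(1)[of v] by (auto simp: T_def mem_Times_iff)
    qed
    ultimately show "x \<in> ?R" by blast
  next
    fix x assume "x \<in> ?R"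
    then have c: "x \<in> configurations (insert dia S)" and x: "\<And>y. y \<in> Y \<Longrightarrow> fill dia x y \<in> X"
      by blast+
    define a where "a i = the (x (vec i))" for i
    have a: "a i \<in> insert dia S" "x (vec i) = Some (a i)" for i
      using configurationsD[OF c, of "vec i"] by (auto simp: a_def)
    define R where "R z i n = reach V E lab (\<lambda>k. fl (a k) (\<mu> (z k))) (i - int n) n" for z i n
    define U where "U i = {(z i, R z i n) | z n. z \<in> paths W F}" for i
    have start: "(q, start (a i) q) \<in> U i" if q: "q \<in> W'" for q i
    proof -
      obtain z where z: "z \<in> paths W F" "z i = q" using through[OF q] by blast
      then have "R z i 0 = start (a i) q" by (simp add: R_def start_def)
      with z show ?thesis unfolding U_def by (metis (mono_tags, lifting) mem_Collect_eq)
    qed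
    have nonempty: "(q, {}) \<notin> U i" for q i
    proof
      assume "(q, {}) \<in> U i"
      then obtain z n where z: "z \<in> paths W F" and empty: "R z i n = {}" unfolding U_def by auto
      define y where "y v = Some (\<mu> (z (co v)))" for v
      have y: "y (vec i) = Some (\<mu> (z i))" for i by (simp add: y_def co(1))
      then have "y \<in> Y" using z unfolding Y_eq by blast
      then obtain w where "w \<in> paths V E" "\<And>i. fill dia x y (vec i) = Some (lab (w i))"
        using x unfolding X_eq by blast
      then have "\<exists>w\<in>paths V E. \<forall>i. lab (w i) = fl (a i) (\<mu> (z i))"
        using fill_eq[of x _ _ y, OF a(2) y] by blast
      then have "R z i n \<noteq> {}"
        using labelled_path_iff_reach[OF V, of E lab "\<lambda>k. fl (a k) (\<mu> (z k))"]
        by (simp add: R_def)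
      then show False using empty by simp
    qed
    have succ: "(q', succ (a (i + 1)) q' Q) \<in> U (i + 1)"
      if Q: "(q, Q) \<in> U i" and q': "q' \<in> W'" "F q q'" for q Q q' i
    proof -
      obtain z n where z: "z \<in> paths W F" "q = z i" "Q = R z i n" using Q unfolding U_def by blast
      obtain z' where z': "z' \<in> paths W F" "z' (i + 1) = q'" using through[OF q'(1)] by blast
      \<comment> \<open>The past of \<open>z\<close> produced \<open>Q\<close>; only the future is replaced by one that starts in \<open>q'\<close>.\<close>
      define g where "g = (\<lambda>k. if k \<le> i then z k else z' k)"
      have g: "g \<in> paths W F"
        unfolding g_def by (rule paths_glue[OF z(1) z'(1)]) (use z z' q' in simp)
      have gq: "g (i + 1) = q'" using z' by (simp add: g_def)
      have "R g i n = Q"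
        unfolding z(3) R_def by (rule reach_cong) (simp add: g_def)
      moreover have "R g (i + 1) (Suc n) = succ (a (i + 1)) q' (R g i n)"
        by (simp add: R_def succ_def gq)
      ultimately have "(q', succ (a (i + 1)) q' Q) = (g (i + 1), R g (i + 1) (Suc n))"
        using gq by simp
      with g show ?thesis unfolding U_def by blast
    qed
    define t where "t v = (a (co v), U (co v))" for v
    have "U i \<subseteq> W' \<times> Pow V" for i
      using reach_subset unfolding U_def R_def W'_def by fast
    then have "range t \<subseteq> T" using a(1) by (auto simp: t_def T_def)
    moreover have "A (translate v t)" for v
    proof -
      have "co (vec 1 + v) = co v + 1" by (simp only: co add.commute)
      then have nxt: "translate v t (vec 1) = (a (co v + 1), U (co v + 1))"
        by (simp only: translate_apply t_def)
      have "translate v t 0 = (a (co v), U (co v))" by (simp add: t_def)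
      then show ?thesis
        unfolding A_def ok_def nxt using start nonempty succ by auto
    qed
    moreover have "x v = Some (fst (t v))" for v using a(2)[of "co v"] by (simp add: t_def co(2))
    ultimately show "x \<in> ?L" unfolding tilings_def by blast
  qed
  ultimately show ?thesis by simp
qed

theorem proposition2:
  fixes S :: "'a set" and dia :: 'a and X Y :: "('d::finite, 'a) pattern set"
  assumes "finite S" and "dia \<notin> S"
    and "is_sofic S X" and "is_sofic S Y"
  shows "is_sofic (insert dia S) (existential_extension dia S X Y) \<and>
    (CARD('d) = 1 \<longrightarrow> is_sofic (insert dia S) (universal_extension dia S X Y))"
  unfolding existential_extension_pointwise[OF assms] universal_extension_pointwise[OF assms(3,4)]
  using is_sofic_existential_pointwise[OF assms(1,3,4)]
    is_sofic_universal_pointwise_line[OF _ assms(1,3,4)] by blast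

end
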